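(* Let $n\geq 5$ be odd, let $1\leq p\leq \frac{n-3}{2}$ be an integer and let $e=\binom{n}{2}-\left(\frac{n+1}{2}+p\right)$. Then $$\rho_{min}(n,e)=\frac{n-5+\sqrt{n(n+2)-8p-3}}{2},$$ and the minimizers in $\mathcal{G}_{n,e}$ are of the form $G^2_{n-2(p+1)+1}\vee G^3_{2(p+1)-1}$, i.e. the join of an $(n-2p-3)$-regular graph on $n-2p-1$ vertices with a $(2p-2)$-regular graph on $2p+1$ vertices.
   Context: All graphs are finite, simple and undirected. $\mathcal{G}_{n,e}$ is the set of all connected simple graphs on $n$ vertices with $e$ edges; $\rho(G)$ is the largest eigenvalue of the adjacency matrix of $G$; $\rho_{min}(n,e)=\min\{\rho(G):G\in\mathcal{G}_{n,e}\}$ and a minimizer of $\mathcal{G}_{n,e}$ is a graph in $\mathcal{G}_{n,e}$ attaining it. For natural numbers $m,r$, $G^r_m$ denotes an $(m-r)$-regular graph on $m$ vertices. The join $G\vee H$ of vertex-disjoint graphs is obtained from their disjoint union by adding all edges between vertices of $G$ and vertices of $H$. *)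

theory Defs
  imports Complex_Main "Jordan_Normal_Form.Char_Poly"
begin

record 'a sgraph =
  sverts :: "'a set"
  sedges :: "'a set set"

definition simple_graph :: "'a sgraph \<Rightarrow> bool" where
  "simple_graph G \<longleftrightarrow>
     finite (sverts G) \<and> sedges G \<subseteq> {s. s \<subseteq> sverts G \<and> card s = 2}"

definition sadj :: "'a sgraph \<Rightarrow> 'a \<Rightarrow> 'a \<Rightarrow> bool" where
  "sadj G u v \<longleftrightarrow> {u, v} \<in> sedges G"

definition sconnected :: "'a sgraph \<Rightarrow> bool" where
  "sconnected G \<longleftrightarrow>
     sverts G \<noteq> {} \<and> (\<forall>u\<in>sverts G. \<forall>v\<in>sverts G. (sadj G)\<^sup>*\<^sup>* u v)"

definition sdegree :: "'a sgraph \<Rightarrow> 'a \<Rightarrow> nat" where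
  "sdegree G v = card {u \<in> sverts G. sadj G v u}"

definition sregular :: "nat \<Rightarrow> 'a sgraph \<Rightarrow> bool" where
  "sregular d G \<longleftrightarrow> (\<forall>v\<in>sverts G. sdegree G v = d)"

(* Rows and columns follow the increasing enumeration of the vertices; the
   spectrum does not depend on this choice. *)
definition adj_matrix :: "('a :: linorder) sgraph \<Rightarrow> real mat" where
  "adj_matrix G =
     (let vs = sorted_list_of_set (sverts G); n = card (sverts G)
      in mat n n (\<lambda>(i, j). if sadj G (vs ! i) (vs ! j) then 1 else 0))"

(* The matrix is real symmetric, so all its eigenvalues are real. For a
   graph without vertices the value is unspecified. *)
definition spec_rad :: "('a :: linorder) sgraph \<Rightarrow> real" where
  "spec_rad G = Max {k. eigenvalue (adj_matrix G) k}"

(* Vertices are natural numbers: every finite graph has an isomorphic copy on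
   each n-element set of naturals, so no isomorphism type is lost. *)
definition conn_graphs :: "nat \<Rightarrow> nat \<Rightarrow> nat sgraph set" where
  "conn_graphs n e =
     {G. simple_graph G \<and> sconnected G \<and>
         card (sverts G) = n \<and> card (sedges G) = e}"

definition rho_min :: "nat \<Rightarrow> nat \<Rightarrow> real" where
  "rho_min n e = (LEAST r. r \<in> spec_rad ` conn_graphs n e)"

definition minimizers :: "nat \<Rightarrow> nat \<Rightarrow> nat sgraph set" where
  "minimizers n e = {G \<in> conn_graphs n e. spec_rad G = rho_min n e}"

(* The graphs denoted by G with superscript r and subscript m; "r \<le> m" keeps
   "m - r" from being truncated. *)
definition coregular :: "nat \<Rightarrow> nat \<Rightarrow> 'a sgraph \<Rightarrow> bool" where
  "coregular r m G \<longleftrightarrow>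
     simple_graph G \<and> card (sverts G) = m \<and> r \<le> m \<and> sregular (m - r) G"

(* Only meaningful for vertex-disjoint arguments. *)
definition sjoin :: "'a sgraph \<Rightarrow> 'a sgraph \<Rightarrow> 'a sgraph" where
  "sjoin G H =
     \<lparr>sverts = sverts G \<union> sverts H,
      sedges = sedges G \<union> sedges H \<union> {{u, v} | u v. u \<in> sverts G \<and> v \<in> sverts H}\<rparr>"

end

theory Submission
  imports Defs "HOL-Analysis.Function_Topology"
begin

text \<open>
  Let \<open>c\<close> be the degree function of the complement of \<open>G\<close>, let \<open>\<mu> - 1\<close> be the claimed minimum and
  test the Rayleigh quotient of \<open>G\<close> on \<open>y v = 1 / (\<mu> + c v)\<close>. With \<open>Y\<close> the sum of \<open>y\<close>, the form of
  \<open>A - (\<mu> - 1) I\<close> at \<open>y\<close> equals \<open>(Y - 1)\<^sup>2 + (Y - 1)\<close> plus the sum of \<open>(y u - y v)\<^sup>2\<close> over the edges of the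
  complement. The degrees \<open>c v\<close> are integers with average between 1 and 2, so by convexity \<open>Y\<close> is
  smallest when they all lie in \<open>{1, 2}\<close>, and \<open>\<mu>\<close> is chosen so that \<open>Y = 1\<close> then. Hence the spectral
  radius is at least \<open>\<mu> - 1\<close>. Equality forces \<open>c\<close> to take only the values 1 and 2 and to be constant
  along complement edges, which means that \<open>G\<close> is a join of the required form; conversely \<open>y\<close> is then a
  positive eigenvector.
\<close>

section \<open>Top eigenvalue of a real symmetric form by compactness\<close>

text \<open>Tychonoff in the full function space: pinning the coordinates outside \<open>V\<close>
  to 0 makes every factor compact.\<close>

lemma compact_coordinate_box:
  fixes V :: "'a set"
  shows "compact {x :: 'a \<Rightarrow> real. \<forall>v. x v \<in> (if v \<in> V then {-1..1} else {0})}"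
proof -
  have "compactin (product_topology (\<lambda>i. euclidean) UNIV)
      (PiE UNIV (\<lambda>v :: 'a. if v \<in> V then {-1..1::real} else {0}))"
    by (subst compactin_PiE) auto
  moreover have "PiE UNIV (\<lambda>v :: 'a. if v \<in> V then {-1..1::real} else {0})
      = {x. \<forall>v. x v \<in> (if v \<in> V then {-1..1} else {0})}"
    by (auto simp: PiE_def Pi_def extensional_def)
  ultimately show ?thesis
    by (simp add: euclidean_product_topology)
qed

text \<open>A zero of a nonnegative form is a minimum, so the first variation vanishes there. Moving
  \<open>x\<close> by \<open>t\<close> in coordinate \<open>w\<close> gives
  \<open>2 * t * L + t\<^sup>2 * b w w\<close>, which is nonnegative for all \<open>t\<close> only
  if \<open>L = 0\<close>.\<close>

lemma psd_form_zero_imp_kernel: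
  fixes b :: "'a \<Rightarrow> 'a \<Rightarrow> real"
  assumes "finite V"
    and sym: "\<And>u v. u \<in> V \<Longrightarrow> v \<in> V \<Longrightarrow> b u v = b v u"
    and psd: "\<And>y. 0 \<le> (\<Sum>v\<in>V. \<Sum>u\<in>V. b v u * y u * y v)"
    and zero: "(\<Sum>v\<in>V. \<Sum>u\<in>V. b v u * x u * x v) = 0"
    and w: "w \<in> V"
  shows "(\<Sum>u\<in>V. b w u * x u) = 0"
proof -
  define L where "L = (\<Sum>u\<in>V. b w u * x u)"
  have L': "(\<Sum>v\<in>V. b v w * x v) = L"
    unfolding L_def using sym w by (intro sum.cong) auto
  have expand: "(\<Sum>v\<in>V. \<Sum>u\<in>V. b v u * (x u + t * of_bool (u = w)) * (x v + t * of_bool (v = w)))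
      = 2 * t * L + t\<^sup>2 * b w w" for t
  proof -
    have "(\<Sum>v\<in>V. \<Sum>u\<in>V. b v u * (x u + t * of_bool (u = w)) * (x v + t * of_bool (v = w)))
      = (\<Sum>v\<in>V. (\<Sum>u\<in>V. b v u * x u * x v) + t * (b v w * x v)
          + (if v = w then t * L + t\<^sup>2 * b w w else 0))"
    proof (rule sum.cong[OF refl])
      fix v assume "v \<in> V"
      have "(\<Sum>u\<in>V. b v u * (x u + t * of_bool (u = w)) * (x v + t * of_bool (v = w)))
        = (\<Sum>u\<in>V. b v u * x u * x v + (if u = w then t * (b v w * x v) else 0)
            + (if v = w then t * (b w u * x u) else 0)
            + (if u = w then if v = w then t\<^sup>2 * b w w else 0 else 0))"
        by (rule sum.cong) (auto simp: algebra_simps power2_eq_square)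
      also have "\<dots> = (\<Sum>u\<in>V. b v u * x u * x v) + t * (b v w * x v)
          + (if v = w then t * L + t\<^sup>2 * b w w else 0)"
        using \<open>finite V\<close> w
        by (auto simp: sum.distrib L_def sum_distrib_left)
      finally show "(\<Sum>u\<in>V. b v u * (x u + t * of_bool (u = w)) * (x v + t * of_bool (v = w))) = \<dots>" .
    qed
    also have "\<dots> = 2 * t * L + t\<^sup>2 * b w w"
      using \<open>finite V\<close> w zero by (simp add: sum.distrib flip: sum_distrib_left) (simp add: L')
    finally show ?thesis .
  qed
  have nonneg: "0 \<le> 2 * t * L + t\<^sup>2 * b w w" for t
    using psd[of "\<lambda>u. x u + t * of_bool (u = w)"] unfolding expand .
  \<comment> \<open>A positive strict upper bound for \<open>b w w\<close>, whatever its sign; at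
    \<open>t = - L / d\<close> the form is then at most \<open>- (L\<^sup>2 / d)\<close>.\<close>
  define d where "d = \<bar>b w w\<bar> + 1"
  have "d > 0" "b w w < d" by (auto simp: d_def)
  have "0 \<le> 2 * (- L / d) * L + (- L / d)\<^sup>2 * b w w" by (rule nonneg)
  also have "\<dots> \<le> 2 * (- L / d) * L + (- L / d)\<^sup>2 * d"
    using \<open>b w w < d\<close> by (intro add_left_mono mult_left_mono) auto
  also have "\<dots> = - (L\<^sup>2 / d)"
    using \<open>d > 0\<close> by (simp add: field_simps power2_eq_square)
  finally have "L\<^sup>2 \<le> 0" using \<open>d > 0\<close> by (simp add: field_simps)
  then show ?thesis by (simp add: L_def)
qed

text \<open>The form attains its maximum \<open>m\<close> on the unit sphere. Then \<open>m\<close>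
  times the squared norm minus the form is nonnegative and vanishes at the maximizer, whose kernel
  equation is the eigenvalue equation.\<close>

lemma symmetric_form_top_eigenpair:
  fixes a :: "'a \<Rightarrow> 'a \<Rightarrow> real"
  assumes "finite V" "V \<noteq> {}"
    and sym: "\<And>u v. u \<in> V \<Longrightarrow> v \<in> V \<Longrightarrow> a u v = a v u"
  obtains m x where "\<exists>v\<in>V. x v \<noteq> 0" "\<And>v. v \<in> V \<Longrightarrow> (\<Sum>u\<in>V. a v u * x u) = m * x v"
    "\<And>y. (\<Sum>v\<in>V. \<Sum>u\<in>V. a v u * y u * y v) \<le> m * (\<Sum>v\<in>V. (y v)\<^sup>2)"
proof -
  define q where "q y = (\<Sum>v\<in>V. \<Sum>u\<in>V. a v u * y u * y v)" for y
  define N where "N y = (\<Sum>v\<in>V. (y v)\<^sup>2)" for y :: "'a \<Rightarrow> real"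
  \<comment> \<open>The unit sphere, with functions extended by 0 outside \<open>V\<close>. The box
    already contains it and supplies compactness.\<close>
  define S where "S = {x :: 'a \<Rightarrow> real. \<forall>v. x v \<in> (if v \<in> V then {-1..1} else {0})} \<inter> {x. N x = 1}"
  have coord: "continuous_on UNIV (\<lambda>x :: 'a \<Rightarrow> real. x v)" for v
    by (rule continuous_on_product_coordinates)
  have "continuous_on UNIV q" "continuous_on UNIV N"
    unfolding q_def N_def by (intro continuous_intros coord)+
  then have "closed {x. N x = 1}"
    by (intro closed_Collect_eq continuous_intros) auto
  then have "compact S"
    unfolding S_def by (intro compact_Int_closed compact_coordinate_box)
  obtain v0 where "v0 \<in> V" using \<open>V \<noteq> {}\<close> by auto
  have "N (\<lambda>v. of_bool (v = v0)) = (\<Sum>v\<in>V. if v = v0 then 1 else 0)"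
    unfolding N_def by (intro sum.cong) auto
  then have "(\<lambda>v. of_bool (v = v0)) \<in> S"
    using \<open>v0 \<in> V\<close> \<open>finite V\<close> by (auto simp: S_def)
  then have "S \<noteq> {}" by blast
  then obtain x where x: "x \<in> S" and max: "\<And>y. y \<in> S \<Longrightarrow> q y \<le> q x"
    using continuous_attains_sup[OF \<open>compact S\<close> _ continuous_on_subset[OF \<open>continuous_on UNIV q\<close>]]
    by blast
  have bound: "q y \<le> q x * N y" for y
  proof (cases "N y = 0")
    case True
    then have "\<forall>v\<in>V. y v = 0"
      using \<open>finite V\<close> by (simp add: N_def sum_nonneg_eq_0_iff)
    then show ?thesis using True by (simp add: q_def)
  next
    case False
    define s where "s = sqrt (N y)"
    have "N y \<ge> 0" unfolding N_def by (intro sum_nonneg) auto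
    with False have s: "s > 0" "s\<^sup>2 = N y" by (auto simp: s_def)
    \<comment> \<open>Normalizing alone does not reach \<open>S\<close>: \<open>y\<close> may be
      nonzero outside \<open>V\<close>. Neither \<open>q\<close> nor \<open>N\<close> sees the
      cutoff.\<close>
    define z where "z v = (if v \<in> V then y v / s else 0)" for v
    have "N z = N y / s\<^sup>2"
      by (simp add: N_def z_def power_divide sum_divide_distrib)
    then have Nz: "N z = 1" using s False by simp
    have "\<bar>z v\<bar> \<le> 1" if "v \<in> V" for v
    proof -
      have "(z v)\<^sup>2 \<le> N z" unfolding N_def
        using that \<open>finite V\<close> by (intro member_le_sum) auto
      then show ?thesis using Nz by (simp add: abs_square_le_1)
    qed
    moreover have "z v = 0" if "v \<notin> V" for v using that by (simp add: z_def)
    ultimately have "z \<in> S" using Nz by (simp add: S_def abs_le_iff minus_le_iff)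
    then have "q z \<le> q x" by (rule max)
    moreover have "q z = q y / s\<^sup>2"
      by (simp add: q_def z_def sum_divide_distrib power2_eq_square)
    moreover have "N y > 0" using s by (metis zero_less_power)
    ultimately show ?thesis using s by (simp add: field_simps)
  qed
  define b where "b v u = (if v = u then q x else 0) - a v u" for v u
  have qb: "(\<Sum>v\<in>V. \<Sum>u\<in>V. b v u * y u * y v) = q x * N y - q y" for y
  proof -
    have "(\<Sum>v\<in>V. \<Sum>u\<in>V. b v u * y u * y v)
      = (\<Sum>v\<in>V. (\<Sum>u\<in>V. (if v = u then q x * (y v)\<^sup>2 else 0) - a v u * y u * y v))"
      by (intro sum.cong refl) (auto simp: b_def algebra_simps power2_eq_square)
    also have "\<dots> = q x * N y - q y"
      using \<open>finite V\<close> by (simp add: sum_subtractf q_def N_def sum_distrib_left)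
    finally show ?thesis .
  qed
  have "N x = 1" using x by (simp add: S_def)
  have ker: "(\<Sum>u\<in>V. b w u * x u) = 0" if "w \<in> V" for w
  proof (rule psd_form_zero_imp_kernel[OF \<open>finite V\<close> _ _ _ that])
    show "b u v = b v u" if "u \<in> V" "v \<in> V" for u v
      using sym that by (simp add: b_def)
    show "0 \<le> (\<Sum>v\<in>V. \<Sum>u\<in>V. b v u * y u * y v)" for y
      using bound[of y] by (simp add: qb)
    show "(\<Sum>v\<in>V. \<Sum>u\<in>V. b v u * x u * x v) = 0"
      using \<open>N x = 1\<close> by (simp add: qb)
  qed
  have "(\<Sum>u\<in>V. a w u * x u) = q x * x w" if "w \<in> V" for w
  proof -
    have "(\<Sum>u\<in>V. b w u * x u) = (\<Sum>u\<in>V. (if w = u then q x * x w else 0) - a w u * x u)"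
      by (intro sum.cong refl) (auto simp: b_def algebra_simps)
    also have "\<dots> = q x * x w - (\<Sum>u\<in>V. a w u * x u)"
      using \<open>finite V\<close> that by (simp add: sum_subtractf)
    finally show ?thesis using ker[OF that] by simp
  qed
  moreover have "\<exists>v\<in>V. x v \<noteq> 0"
    using \<open>N x = 1\<close> unfolding N_def by (metis (mono_tags) power_zero_numeral sum.neutral zero_neq_one)
  ultimately show ?thesis using that bound unfolding q_def N_def by blast
qed

section \<open>Spectral radius through functions on the vertices\<close>

text \<open>Vertex-indexed, so that later arguments never meet the enumeration behind
  \<open>adj_matrix\<close>.\<close>

definition is_adj_eigenpair :: "'a sgraph \<Rightarrow> real \<Rightarrow> ('a \<Rightarrow> real) \<Rightarrow> bool" where
  "is_adj_eigenpair G k x \<longleftrightarrow>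
     (\<exists>v\<in>sverts G. x v \<noteq> 0) \<and>
     (\<forall>v\<in>sverts G. (\<Sum>u\<in>sverts G. of_bool (sadj G v u) * x u) = k * x v)"

lemma eigenvalue_adj_matrix_iff:
  assumes "finite (sverts G)"
  shows "eigenvalue (adj_matrix G) k \<longleftrightarrow> (\<exists>x. is_adj_eigenpair G k x)"
proof -
  define vs where "vs = sorted_list_of_set (sverts G)"
  define n where "n = card (sverts G)"
  have bij: "bij_betw (nth vs) {..<n} (sverts G)"
    by (rule bij_betw_nth) (use assms in \<open>simp_all add: vs_def n_def\<close>)
  define idx where "idx = inv_into {..<n} (nth vs)"
  have idx: "idx (vs ! i) = i" if "i < n" for i
    using bij that by (simp add: idx_def bij_betw_def)
  have row: "((adj_matrix G) *\<^sub>v vec n (\<lambda>i. x (vs ! i))) $ i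
      = (\<Sum>u\<in>sverts G. of_bool (sadj G (vs ! i) u) * x u)" if "i < n" for x i
  proof -
    have "((adj_matrix G) *\<^sub>v vec n (\<lambda>i. x (vs ! i))) $ i
        = (\<Sum>j = 0..<n. (if sadj G (vs ! i) (vs ! j) then 1 else 0) * x (vs ! j))"
      using that by (simp add: adj_matrix_def Let_def scalar_prod_def flip: vs_def n_def)
    also have "\<dots> = (\<Sum>j\<in>{..<n}. of_bool (sadj G (vs ! i) (vs ! j)) * x (vs ! j))"
      by (intro sum.cong) auto
    also have "\<dots> = (\<Sum>u\<in>sverts G. of_bool (sadj G (vs ! i) u) * x u)"
      by (rule sum.reindex_bij_betw[OF bij])
    finally show ?thesis .
  qed
  have dim: "dim_row (adj_matrix G) = n"
    by (simp add: adj_matrix_def Let_def n_def)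
  have all: "(\<forall>v\<in>sverts G. P v) \<longleftrightarrow> (\<forall>i<n. P (vs ! i))" for P
    by (subst bij_betw_imp_surj_on[OF bij, symmetric]) auto
  have ev: "eigenvector (adj_matrix G) (vec n (\<lambda>i. x (vs ! i))) k \<longleftrightarrow> is_adj_eigenpair G k x" for x
  proof -
    have "vec n (\<lambda>i. x (vs ! i)) \<noteq> 0\<^sub>v n \<longleftrightarrow> \<not> (\<forall>i<n. x (vs ! i) = 0)"
      by (auto simp: vec_eq_iff)
    moreover have "adj_matrix G *\<^sub>v vec n (\<lambda>i. x (vs ! i)) = k \<cdot>\<^sub>v vec n (\<lambda>i. x (vs ! i))
      \<longleftrightarrow> (\<forall>i<n. (adj_matrix G *\<^sub>v vec n (\<lambda>i. x (vs ! i))) $ i = k * x (vs ! i))"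
      by (auto simp: vec_eq_iff dim)
    ultimately show ?thesis
      using row all[of "\<lambda>v. x v = 0"]
        all[of "\<lambda>v. (\<Sum>u\<in>sverts G. of_bool (sadj G v u) * x u) = k * x v"]
      by (auto simp: eigenvector_def is_adj_eigenpair_def dim)
  qed
  \<comment> \<open>Conversely, every eigenvector comes from a function on the vertices, read off
    through the inverse enumeration \<open>idx\<close>.\<close>
  have "\<exists>x. w = vec n (\<lambda>i. x (vs ! i))" if "eigenvector (adj_matrix G) w k" for w
  proof -
    have "w = vec n (\<lambda>i. w $ idx (vs ! i))"
      using that idx by (auto simp: vec_eq_iff eigenvector_def dim)
    then show ?thesis by (rule exI[of _ "\<lambda>v. w $ idx v"])
  qed
  then show ?thesis
    unfolding eigenvalue_def using ev by metis
qed

text \<open>Eigenvalues are roots of a nonzero polynomial; finiteness gives the \<open>Max\<close>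
  in \<open>spec_rad\<close> its meaning.\<close>

lemma finite_eigenvalues_adj_matrix: "finite {k. eigenvalue (adj_matrix G) k}"
proof -
  have A: "adj_matrix G \<in> carrier_mat (card (sverts G)) (card (sverts G))"
    by (simp add: adj_matrix_def Let_def)
  then have "char_poly (adj_matrix G) \<noteq> 0"
    using degree_monic_char_poly[OF A] by auto
  then show ?thesis
    using poly_roots_finite by (simp add: eigenvalue_root_char_poly[OF A])
qed

lemma sadj_commute: "sadj G u v \<longleftrightarrow> sadj G v u"
  by (simp add: sadj_def insert_commute)

lemma form_adj_eigenpair:
  assumes "is_adj_eigenpair G k x"
  shows "(\<Sum>v\<in>sverts G. \<Sum>u\<in>sverts G. of_bool (sadj G v u) * x u * x v)
    = k * (\<Sum>v\<in>sverts G. (x v)\<^sup>2)"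
proof -
  have "(\<Sum>u\<in>sverts G. of_bool (sadj G v u) * x u * x v) = k * (x v)\<^sup>2" if "v \<in> sverts G" for v
    using assms that
    by (simp add: is_adj_eigenpair_def power2_eq_square del: sum_of_bool_mult_eq flip: sum_distrib_right)
  then show ?thesis by (simp add: sum_distrib_left)
qed

lemma adj_eigenpair_square_pos:
  assumes "finite (sverts G)" "is_adj_eigenpair G k x"
  shows "(\<Sum>v\<in>sverts G. (x v)\<^sup>2) > 0"
  using assms unfolding is_adj_eigenpair_def by (auto intro: sum_pos2)

text \<open>The maximum \<open>m\<close> of the Rayleigh quotient is itself an eigenvalue, and it
  bounds every other eigenvalue when tested on an eigenvector of the latter; hence it is
  \<open>spec_rad G\<close>.\<close>

lemma spec_rad_rayleigh:
  assumes "finite (sverts G)" "sverts G \<noteq> {}"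
  shows "\<exists>x. is_adj_eigenpair G (spec_rad G) x"
    and "(\<Sum>v\<in>sverts G. \<Sum>u\<in>sverts G. of_bool (sadj G v u) * y u * y v)
      \<le> spec_rad G * (\<Sum>v\<in>sverts G. (y v)\<^sup>2)"
proof -
  let ?V = "sverts G"
  have sym: "of_bool (sadj G u v) = (of_bool (sadj G v u) :: real)" for u v
    by (simp add: sadj_commute)
  obtain m x where x: "is_adj_eigenpair G m x"
    and bound: "\<And>y. (\<Sum>v\<in>?V. \<Sum>u\<in>?V. of_bool (sadj G v u) * y u * y v) \<le> m * (\<Sum>v\<in>?V. (y v)\<^sup>2)"
  proof (rule symmetric_form_top_eigenpair[where a = "\<lambda>u v. of_bool (sadj G u v)", OF assms sym])
    fix m :: real and x
    assume "\<exists>v\<in>?V. x v \<noteq> 0"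
      and "\<And>v. v \<in> ?V \<Longrightarrow> (\<Sum>u\<in>?V. of_bool (sadj G v u) * x u) = m * x v"
      and bd: "\<And>y. (\<Sum>v\<in>?V. \<Sum>u\<in>?V. of_bool (sadj G v u) * y u * y v) \<le> m * (\<Sum>v\<in>?V. (y v)\<^sup>2)"
    then have "is_adj_eigenpair G m x" unfolding is_adj_eigenpair_def by blast
    then show thesis using bd by (rule that)
  qed
  then have "eigenvalue (adj_matrix G) m"
    unfolding eigenvalue_adj_matrix_iff[OF assms(1)] by (intro exI)
  moreover have "k \<le> m" if k: "eigenvalue (adj_matrix G) k" for k
  proof -
    obtain z where z: "is_adj_eigenpair G k z"
      using k unfolding eigenvalue_adj_matrix_iff[OF assms(1)] by blast
    have "k * (\<Sum>v\<in>?V. (z v)\<^sup>2) \<le> m * (\<Sum>v\<in>?V. (z v)\<^sup>2)"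
      using bound[of z] unfolding form_adj_eigenpair[OF z] .
    then show ?thesis
      using adj_eigenpair_square_pos[OF assms(1) z] by simp
  qed
  ultimately have "spec_rad G = m"
    unfolding spec_rad_def by (intro Max_eqI finite_eigenvalues_adj_matrix) auto
  then show "\<exists>x. is_adj_eigenpair G (spec_rad G) x"
    and "(\<Sum>v\<in>?V. \<Sum>u\<in>?V. of_bool (sadj G v u) * y u * y v) \<le> spec_rad G * (\<Sum>v\<in>?V. (y v)\<^sup>2)"
    using x bound by auto
qed

text \<open>Stands in for Perron-Frobenius. The Rayleigh bound gives
  \<open>l \<le> spec_rad G\<close>; for the converse, AM-GM with weights from the positive
  \<open>x\<close> bounds the form at any \<open>z\<close> by \<open>l\<close> times the squared
  norm of \<open>z\<close>.\<close>

lemma spec_rad_eq_of_pos_eigenvector: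
  assumes "finite (sverts G)" "is_adj_eigenpair G l x"
    and pos: "\<And>v. v \<in> sverts G \<Longrightarrow> x v > 0"
  shows "spec_rad G = l"
proof -
  let ?V = "sverts G"
  have ne: "?V \<noteq> {}" using assms(2) by (auto simp: is_adj_eigenpair_def)
  obtain z where z: "is_adj_eigenpair G (spec_rad G) z"
    using spec_rad_rayleigh(1)[OF assms(1) ne] by blast
  have ev: "(\<Sum>u\<in>?V. of_bool (sadj G v u) * x u) = l * x v" if "v \<in> ?V" for v
    using assms(2) that by (simp add: is_adj_eigenpair_def)
  have "l \<le> spec_rad G"
    using spec_rad_rayleigh(2)[OF assms(1) ne, of x] form_adj_eigenpair[OF assms(2)] adj_eigenpair_square_pos[OF assms(1,2)]
    by simp
  moreover have "spec_rad G \<le> l"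
  proof -
    \<comment> \<open>One half of the AM-GM bound for \<open>z u * z v\<close>; summing over
      \<open>u\<close> with the eigenvalue equation leaves \<open>l * (z v)\<^sup>2\<close>.\<close>
    let ?w = "\<lambda>v u. of_bool (sadj G v u) * x u * ((z v)\<^sup>2 / x v)"
    have "spec_rad G * (\<Sum>v\<in>?V. (z v)\<^sup>2) = (\<Sum>v\<in>?V. \<Sum>u\<in>?V. of_bool (sadj G v u) * z u * z v)"
      using form_adj_eigenpair[OF z] by simp
    also have "\<dots> \<le> (\<Sum>v\<in>?V. \<Sum>u\<in>?V. (?w v u + ?w u v) / 2)"
    proof (intro sum_mono)
      fix v u assume vu: "v \<in> ?V" "u \<in> ?V"
      have "0 \<le> (x u * z v - x v * z u)\<^sup>2 / (2 * x u * x v)"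
        using pos vu by (intro divide_nonneg_nonneg) (auto intro!: mult_nonneg_nonneg less_imp_le)
      also have "\<dots> = (x u * ((z v)\<^sup>2 / x v) + x v * ((z u)\<^sup>2 / x u)) / 2 - z u * z v"
        using pos[of u] pos[of v] vu by (simp add: field_simps power2_eq_square)
      finally show "of_bool (sadj G v u) * z u * z v \<le> (?w v u + ?w u v) / 2"
        by (cases "sadj G v u") (auto simp: sadj_commute[of G u v])
    qed
    also have "\<dots> = ((\<Sum>v\<in>?V. \<Sum>u\<in>?V. ?w v u) + (\<Sum>v\<in>?V. \<Sum>u\<in>?V. ?w u v)) / 2"
      by (simp add: sum_divide_distrib sum.distrib add_divide_distrib)
    also have "(\<Sum>v\<in>?V. \<Sum>u\<in>?V. ?w u v) = (\<Sum>v\<in>?V. \<Sum>u\<in>?V. ?w v u)"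
      by (rule sum.swap)
    also have "(\<Sum>v\<in>?V. \<Sum>u\<in>?V. ?w v u) = (\<Sum>v\<in>?V. l * (z v)\<^sup>2)"
    proof (rule sum.cong[OF refl])
      fix v assume v: "v \<in> ?V"
      have "(\<Sum>u\<in>?V. ?w v u) = l * x v * ((z v)\<^sup>2 / x v)"
        by (simp only: ev[OF v] flip: sum_distrib_right)
      then show "(\<Sum>u\<in>?V. ?w v u) = l * (z v)\<^sup>2"
        using pos[OF v] by simp
    qed
    finally have "spec_rad G * (\<Sum>v\<in>?V. (z v)\<^sup>2) \<le> l * (\<Sum>v\<in>?V. (z v)\<^sup>2)"
      unfolding sum_distrib_left[symmetric] by simp
    then show ?thesis using adj_eigenpair_square_pos[OF assms(1) z] by simp
  qed
  ultimately show ?thesis by simp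
qed

section \<open>Degrees in the complement\<close>

definition codegree :: "'a sgraph \<Rightarrow> 'a \<Rightarrow> nat" where
  "codegree G v = card {u \<in> sverts G. u \<noteq> v \<and> \<not> sadj G v u}"

text \<open>The equality case of \<open>spec_rad_bound\<close>: the first clause kills the chord
  gaps, the second the differences along complement edges.\<close>

definition codegree_balanced :: "'a sgraph \<Rightarrow> bool" where
  "codegree_balanced G \<longleftrightarrow>
    (\<forall>v\<in>sverts G. codegree G v \<in> {1, 2}) \<and>
    (\<forall>v\<in>sverts G. \<forall>u\<in>sverts G. u \<noteq> v \<longrightarrow> \<not> sadj G v u \<longrightarrow> codegree G u = codegree G v)"

lemma sadj_imp_verts:
  assumes "simple_graph G" "sadj G u v"
  shows "u \<in> sverts G" "v \<in> sverts G" "u \<noteq> v"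
proof -
  have "{u, v} \<subseteq> sverts G" "card {u, v} = 2"
    using assms by (auto simp: simple_graph_def sadj_def)
  then show "u \<in> sverts G" "v \<in> sverts G" "u \<noteq> v" by auto
qed

lemma sdegree_add_codegree:
  assumes "simple_graph G" "v \<in> sverts G"
  shows "sdegree G v + codegree G v + 1 = card (sverts G)"
proof -
  have fin: "finite (sverts G)" using assms by (simp add: simple_graph_def)
  have "sverts G = insert v ({u \<in> sverts G. sadj G v u} \<union> {u \<in> sverts G. u \<noteq> v \<and> \<not> sadj G v u})"
    using assms(2) by auto
  also have "card \<dots> = Suc (card ({u \<in> sverts G. sadj G v u} \<union> {u \<in> sverts G. u \<noteq> v \<and> \<not> sadj G v u}))"
    using fin sadj_imp_verts(3)[OF assms(1)] by (subst card_insert_disjoint) auto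
  also have "card ({u \<in> sverts G. sadj G v u} \<union> {u \<in> sverts G. u \<noteq> v \<and> \<not> sadj G v u})
      = sdegree G v + codegree G v"
    using fin unfolding sdegree_def codegree_def by (subst card_Un_disjoint) auto
  finally show ?thesis by simp
qed

lemma sum_sdegree:
  assumes "simple_graph G"
  shows "(\<Sum>v\<in>sverts G. sdegree G v) = 2 * card (sedges G)"
proof -
  have fin: "finite (sverts G)" and sub: "\<And>s. s \<in> sedges G \<Longrightarrow> s \<subseteq> sverts G \<and> card s = 2"
    using assms by (auto simp: simple_graph_def)
  have "sedges G \<subseteq> Pow (sverts G)" using sub by auto
  then have finE: "finite (sedges G)"
    by (rule finite_subset) (use fin in simp)
  have "sdegree G v = card {s \<in> sedges G. v \<in> s}" if "v \<in> sverts G" for v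
  proof -
    have "{s \<in> sedges G. v \<in> s} = (\<lambda>u. {v, u}) ` {u \<in> sverts G. sadj G v u}"
    proof
      show "{s \<in> sedges G. v \<in> s} \<subseteq> (\<lambda>u. {v, u}) ` {u \<in> sverts G. sadj G v u}"
      proof
        fix s assume s: "s \<in> {s \<in> sedges G. v \<in> s}"
        then obtain a b where "s = {a, b}" using sub card_2_iff[of s] by blast
        then obtain u where "s = {v, u}" using s by auto
        then show "s \<in> (\<lambda>u. {v, u}) ` {u \<in> sverts G. sadj G v u}"
          using s sub[of s] by (auto simp: sadj_def)
      qed
    qed (auto simp: sadj_def)
    moreover have "inj_on (\<lambda>u. {v, u}) {u \<in> sverts G. sadj G v u}"
      by (auto simp: inj_on_def doubleton_eq_iff)
    ultimately show ?thesis by (simp add: sdegree_def card_image)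
  qed
  then have "(\<Sum>v\<in>sverts G. sdegree G v) = (\<Sum>v\<in>sverts G. card {s \<in> sedges G. v \<in> s})"
    by simp
  also have "\<dots> = 2 * card (sedges G)"
  proof (rule sum_multicount[OF fin finE])
    have "{i \<in> sverts G. i \<in> j} = j" if "j \<in> sedges G" for j
      using sub that by blast
    then show "\<forall>j\<in>sedges G. card {i \<in> sverts G. i \<in> j} = 2" using sub by simp
  qed
  finally show ?thesis .
qed

text \<open>The handshake identity for the complement, written additively to avoid truncated
  subtraction. It turns an edge count into a codegree sum.\<close>

lemma sum_codegree:
  assumes "simple_graph G"
  shows "(\<Sum>v\<in>sverts G. codegree G v) + 2 * card (sedges G) + card (sverts G)
    = card (sverts G) * card (sverts G)"
proof -
  have "(\<Sum>v\<in>sverts G. sdegree G v + codegree G v + 1) = (\<Sum>v\<in>sverts G. card (sverts G))"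
    using sdegree_add_codegree[OF assms] by (intro sum.cong) auto
  then show ?thesis
    using sum_sdegree[OF assms] by (simp only: sum.distrib) simp
qed

lemma sum_coadj:
  assumes "finite (sverts G)"
  shows "(\<Sum>u\<in>sverts G. of_bool (u \<noteq> v \<and> \<not> sadj G v u)) = real (codegree G v)"
proof -
  have "sverts G \<inter> {u. u \<noteq> v \<and> \<not> sadj G v u} = {u \<in> sverts G. u \<noteq> v \<and> \<not> sadj G v u}"
    by auto
  then show ?thesis
    using assms by (simp add: sum_of_bool_eq codegree_def)
qed

text \<open>Entrywise \<open>A = J - I - B\<close>, with \<open>J\<close> the all-ones matrix and
  \<open>B\<close> the adjacency matrix of the complement.\<close>

lemma of_bool_sadj:
  assumes "simple_graph G"
  shows "of_bool (sadj G v u) = (1 :: real) - of_bool (u = v) - of_bool (u \<noteq> v \<and> \<not> sadj G v u)"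
  using sadj_imp_verts(3)[OF assms, of v u] by auto

section \<open>The lower bound and its equality case\<close>

text \<open>Substitute \<open>A = J - I - B\<close> and complete squares along complement edges. The
  weights satisfy \<open>(\<mu> + codegree G v) * (y v)\<^sup>2 = y v\<close>, which turns the
  remaining quadratic terms into the plain sum of \<open>y\<close>. Ordered pairs count each
  complement edge twice, hence the division by 2.\<close>

lemma form_inverse_codegree_weights:
  fixes \<mu> :: real
  assumes G: "simple_graph G" and "\<mu> > 0"
  defines "y \<equiv> \<lambda>v. 1 / (\<mu> + real (codegree G v))"
  shows "(\<Sum>v\<in>sverts G. \<Sum>u\<in>sverts G. of_bool (sadj G v u) * y u * y v)
      - (\<mu> - 1) * (\<Sum>v\<in>sverts G. (y v)\<^sup>2)
    = ((\<Sum>v\<in>sverts G. y v) - 1)\<^sup>2 + ((\<Sum>v\<in>sverts G. y v) - 1)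
      + (\<Sum>v\<in>sverts G. \<Sum>u\<in>sverts G. of_bool (u \<noteq> v \<and> \<not> sadj G v u) * (y v - y u)\<^sup>2) / 2"
proof -
  let ?V = "sverts G"
  have fin: "finite ?V" using G by (simp add: simple_graph_def)
  define b where "b v u = (of_bool (u \<noteq> v \<and> \<not> sadj G v u) :: real)" for v u
  have b_sym: "b v u = b u v" for u v
    by (auto simp: b_def sadj_commute)
  have b_sum: "(\<Sum>u\<in>?V. b v u) = real (codegree G v)" for v
    unfolding b_def by (rule sum_coadj[OF fin])
  define Y C B D where "Y = (\<Sum>v\<in>?V. (y v)\<^sup>2)" and "C = (\<Sum>v\<in>?V. real (codegree G v) * (y v)\<^sup>2)"
    and "B = (\<Sum>v\<in>?V. \<Sum>u\<in>?V. b v u * y u * y v)"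
    and "D = (\<Sum>v\<in>?V. \<Sum>u\<in>?V. b v u * (y v - y u)\<^sup>2)"
  have "(\<Sum>v\<in>?V. \<Sum>u\<in>?V. of_bool (sadj G v u) * y u * y v)
      = (\<Sum>v\<in>?V. \<Sum>u\<in>?V. y v * y u - (if u = v then (y v)\<^sup>2 else 0) - b v u * y u * y v)"
    unfolding of_bool_sadj[OF G]
    by (intro sum.cong refl) (auto simp: b_def algebra_simps power2_eq_square)
  also have "\<dots> = (\<Sum>v\<in>?V. y v)\<^sup>2 - Y - B"
    using fin by (simp add: sum_subtractf Y_def B_def power2_eq_square sum_product)
  finally have form: "(\<Sum>v\<in>?V. \<Sum>u\<in>?V. of_bool (sadj G v u) * y u * y v) = (\<Sum>v\<in>?V. y v)\<^sup>2 - Y - B" .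
  have c1: "(\<Sum>v\<in>?V. \<Sum>u\<in>?V. b v u * (y v)\<^sup>2) = C"
    by (simp add: C_def b_sum flip: sum_distrib_right)
  have "(\<Sum>v\<in>?V. \<Sum>u\<in>?V. b v u * (y u)\<^sup>2) = (\<Sum>u\<in>?V. \<Sum>v\<in>?V. b v u * (y u)\<^sup>2)"
    by (rule sum.swap)
  also have "\<dots> = C"
    by (subst b_sym) (rule c1)
  finally have c2: "(\<Sum>v\<in>?V. \<Sum>u\<in>?V. b v u * (y u)\<^sup>2) = C" .
  have "D = (\<Sum>v\<in>?V. \<Sum>u\<in>?V. b v u * (y v)\<^sup>2 + b v u * (y u)\<^sup>2 - 2 * (b v u * y u * y v))"
    unfolding D_def by (intro sum.cong refl) (simp add: algebra_simps power2_eq_square)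
  also have "\<dots> = 2 * C - 2 * B"
    by (simp add: sum_subtractf sum.distrib c1 c2 B_def flip: sum_distrib_left)
  finally have D: "D = 2 * C - 2 * B" .
  have "\<mu> * Y + C = (\<Sum>v\<in>?V. (\<mu> + real (codegree G v)) * (y v)\<^sup>2)"
    by (simp add: Y_def C_def sum_distrib_left sum.distrib algebra_simps)
  also have "\<dots> = (\<Sum>v\<in>?V. y v)"
  proof (rule sum.cong[OF refl])
    fix v
    have "\<mu> + real (codegree G v) > 0" using \<open>\<mu> > 0\<close> by simp
    then show "(\<mu> + real (codegree G v)) * (y v)\<^sup>2 = y v"
      by (simp add: y_def power2_eq_square)
  qed
  finally have "\<mu> * Y + C = (\<Sum>v\<in>?V. y v)" .
  then show ?thesis
    unfolding form Y_def[symmetric] b_def[symmetric] D_def[symmetric] D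
    by (simp add: field_simps power2_eq_square)
qed

text \<open>The summand on the right is the gap between the convex function \<open>x \<mapsto> 1 / (\<mu> + x)\<close> and its
  chord through \<open>1\<close> and \<open>2\<close>; it is nonnegative at every integer.\<close>

lemma sum_inverse_chord:
  fixes \<mu> :: real and c :: "'a \<Rightarrow> nat"
  assumes "\<mu> > 0"
    and root: "(\<mu> + 1) * (\<mu> + 2) = real (card V) * (\<mu> + 2) - (real (\<Sum>v\<in>V. c v) - real (card V))"
  shows "(\<Sum>v\<in>V. 1 / (\<mu> + real (c v))) - 1
    = (\<Sum>v\<in>V. (real (c v) - 1) * (real (c v) - 2) / ((\<mu> + 1) * (\<mu> + 2) * (\<mu> + real (c v))))"
proof -
  let ?d = "(\<mu> + 1) * (\<mu> + 2)"
  have "?d > 0" using \<open>\<mu> > 0\<close> by (intro mult_pos_pos) auto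
  have pt: "1 / (\<mu> + real (c v)) = ((\<mu> + 2) - (real (c v) - 1)) / ?d
      + (real (c v) - 1) * (real (c v) - 2) / (?d * (\<mu> + real (c v)))" for v
  proof -
    have "\<mu> + real (c v) > 0" "\<mu> + 1 > 0" "\<mu> + 2 > 0" using \<open>\<mu> > 0\<close> by auto
    then show ?thesis by (simp add: divide_simps) (simp add: algebra_simps)
  qed
  \<comment> \<open>The chord is affine in \<open>c v\<close>, so its total depends only on the sum
    of \<open>c\<close>; \<open>root\<close> says that this total is 1.\<close>
  have "(\<Sum>v\<in>V. ((\<mu> + 2) - (real (c v) - 1)) / ?d) = (\<Sum>v\<in>V. (\<mu> + 2) - (real (c v) - 1)) / ?d"
    by (simp add: sum_divide_distrib)
  also have "(\<Sum>v\<in>V. (\<mu> + 2) - (real (c v) - 1)) = ?d"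
    unfolding root by (simp add: sum_subtractf sum.distrib algebra_simps)
  finally have "(\<Sum>v\<in>V. ((\<mu> + 2) - (real (c v) - 1)) / ?d) = 1" using \<open>\<mu> > 0\<close> by simp
  moreover have "(\<Sum>v\<in>V. 1 / (\<mu> + real (c v))) = (\<Sum>v\<in>V. ((\<mu> + 2) - (real (c v) - 1)) / ?d)
    + (\<Sum>v\<in>V. (real (c v) - 1) * (real (c v) - 2) / (?d * (\<mu> + real (c v))))"
    unfolding sum.distrib[symmetric] using pt by (intro sum.cong) auto
  ultimately show ?thesis by simp
qed

lemma nat_chord_gap_nonneg: "(real c - 1) * (real c - 2) \<ge> 0"
proof (cases "c \<le> 1")
  case True
  then show ?thesis by (intro mult_nonpos_nonpos) auto
qed auto

text \<open>Two nonnegative defects control the excess of the spectral radius over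
  \<open>\<mu> - 1\<close>: the chord gaps and the variation of the weights along complement
  edges.\<close>

lemma spec_rad_bound:
  fixes \<mu> :: real
  assumes G: "simple_graph G" and ne: "sverts G \<noteq> {}" and mu: "\<mu> > 0"
    and root: "(\<mu> + 1) * (\<mu> + 2) = real (card (sverts G)) * (\<mu> + 2)
      - (real (\<Sum>v\<in>sverts G. codegree G v) - real (card (sverts G)))"
  shows spec_rad_ge: "\<mu> - 1 \<le> spec_rad G"
    and spec_rad_eq_iff: "spec_rad G = \<mu> - 1 \<longleftrightarrow> codegree_balanced G"
proof -
  let ?V = "sverts G"
  have fin: "finite ?V" using G by (simp add: simple_graph_def)
  define y where "y v = 1 / (\<mu> + real (codegree G v))" for v
  define gap where "gap v = (real (codegree G v) - 1) * (real (codegree G v) - 2)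
    / ((\<mu> + 1) * (\<mu> + 2) * (\<mu> + real (codegree G v)))" for v
  define D where "D = (\<Sum>v\<in>?V. \<Sum>u\<in>?V. of_bool (u \<noteq> v \<and> \<not> sadj G v u) * (y v - y u)\<^sup>2)"
  define Y where "Y = (\<Sum>v\<in>?V. (y v)\<^sup>2)"
  have pos: "\<mu> + real (codegree G v) > 0" for v using mu by simp
  then have y_pos: "y v > 0" for v by (simp add: y_def)
  then have "Y > 0" unfolding Y_def by (intro sum_pos fin ne zero_less_power)
  have gap_nonneg: "gap v \<ge> 0" for v
    unfolding gap_def using mu pos by (intro divide_nonneg_pos mult_pos_pos nat_chord_gap_nonneg) auto
  have "D \<ge> 0" unfolding D_def by (intro sum_nonneg) auto
  have y_sum: "(\<Sum>v\<in>?V. y v) - 1 = (\<Sum>v\<in>?V. gap v)"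
    unfolding y_def gap_def by (rule sum_inverse_chord[OF mu root])
  have "(\<Sum>v\<in>?V. gap v) \<ge> 0" using gap_nonneg by (intro sum_nonneg)
  have form: "(\<Sum>v\<in>?V. \<Sum>u\<in>?V. of_bool (sadj G v u) * y u * y v) - (\<mu> - 1) * Y
      = (\<Sum>v\<in>?V. gap v)\<^sup>2 + (\<Sum>v\<in>?V. gap v) + D / 2"
    using form_inverse_codegree_weights[OF G mu] unfolding y_sum[symmetric] unfolding y_def D_def Y_def .
  have "(\<Sum>v\<in>?V. \<Sum>u\<in>?V. of_bool (sadj G v u) * y u * y v) \<le> spec_rad G * Y"
    unfolding Y_def by (rule spec_rad_rayleigh(2)[OF fin ne])
  \<comment> \<open>The square of the gap sum is dropped; the linear term suffices to force every
    gap to 0 in the equality case.\<close>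
  with form have key: "(\<Sum>v\<in>?V. gap v) + D / 2 \<le> (spec_rad G - (\<mu> - 1)) * Y"
    using zero_le_power2[of "\<Sum>v\<in>?V. gap v"] unfolding left_diff_distrib by linarith
  then have "0 \<le> (spec_rad G - (\<mu> - 1)) * Y"
    using \<open>D \<ge> 0\<close> \<open>(\<Sum>v\<in>?V. gap v) \<ge> 0\<close> by linarith
  then show "\<mu> - 1 \<le> spec_rad G"
    using \<open>Y > 0\<close> by (simp add: zero_le_mult_iff)
  show "spec_rad G = \<mu> - 1 \<longleftrightarrow> codegree_balanced G"
    unfolding codegree_balanced_def
  proof (intro iffI conjI ballI impI)
    assume "spec_rad G = \<mu> - 1"
    then have zero: "(\<Sum>v\<in>?V. gap v) = 0" "D = 0"
      using key \<open>D \<ge> 0\<close> \<open>(\<Sum>v\<in>?V. gap v) \<ge> 0\<close> by auto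
    fix v assume v: "v \<in> ?V"
    then have "gap v = 0"
      using zero(1) gap_nonneg fin by (simp add: sum_nonneg_eq_0_iff)
    then have "real (codegree G v) = 1 \<or> real (codegree G v) = 2"
      using mu pos[of v] by (simp add: gap_def)
    then show "codegree G v \<in> {1, 2}" by auto
    fix u assume u: "u \<in> ?V" "u \<noteq> v" "\<not> sadj G v u"
    have "(\<Sum>w\<in>?V. of_bool (w \<noteq> v \<and> \<not> sadj G v w) * (y v - y w)\<^sup>2) = 0"
      using zero(2) fin v unfolding D_def by (subst (asm) sum_nonneg_eq_0_iff) (auto intro!: sum_nonneg)
    then have "of_bool (u \<noteq> v \<and> \<not> sadj G v u) * (y v - y u)\<^sup>2 = 0"
      using fin u(1) by (subst (asm) sum_nonneg_eq_0_iff) auto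
    then have "y v = y u" using u by simp
    then show "codegree G u = codegree G v"
      using pos[of u] pos[of v] by (simp add: y_def)
  next
    assume c: "(\<forall>v\<in>?V. codegree G v \<in> {1, 2}) \<and>
      (\<forall>v\<in>?V. \<forall>u\<in>?V. u \<noteq> v \<longrightarrow> \<not> sadj G v u \<longrightarrow> codegree G u = codegree G v)"
    have "gap v = 0" if "v \<in> ?V" for v
      using c that by (auto simp: gap_def)
    then have y_one: "(\<Sum>v\<in>?V. y v) = 1" using y_sum by simp
    have "(\<Sum>u\<in>?V. of_bool (sadj G v u) * y u) = (\<mu> - 1) * y v" if v: "v \<in> ?V" for v
    proof -
      \<comment> \<open>Complement neighbours of \<open>v\<close> share its codegree and hence its
        weight, so the subtracted \<open>y u\<close> may be replaced by \<open>y v\<close>.\<close>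
      have "(\<Sum>u\<in>?V. of_bool (sadj G v u) * y u)
        = (\<Sum>u\<in>?V. y u - (if u = v then y v else 0) - of_bool (u \<noteq> v \<and> \<not> sadj G v u) * y v)"
        unfolding of_bool_sadj[OF G] using c v
        by (intro sum.cong refl) (auto simp: y_def)
      also have "\<dots> = 1 - y v - real (codegree G v) * y v"
        unfolding sum_subtractf sum_distrib_right[symmetric] sum_coadj[OF fin] y_one
        using fin v by simp
      also have "\<dots> = (\<mu> - 1) * y v"
      proof -
        have "(\<mu> + real (codegree G v)) * y v = 1"
          using pos[of v] by (simp add: y_def)
        then show ?thesis by (simp add: algebra_simps)
      qed
      finally show ?thesis .
    qed
    then have "is_adj_eigenpair G (\<mu> - 1) y"
      using ne y_pos unfolding is_adj_eigenpair_def by (metis all_not_in_conv less_irrefl)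
    then show "spec_rad G = \<mu> - 1"
      using y_pos by (rule spec_rad_eq_of_pos_eigenvector[OF fin])
  qed
qed

section \<open>Joins and their complements\<close>

text \<open>Degree and codegree add up to \<open>m - 1\<close>; \<open>1 \<le> r\<close> and
  \<open>r \<le> m\<close> keep both subtractions exact. The two join factors thus have constant
  codegree 1 and 2.\<close>

lemma coregular_iff_codegree:
  assumes "1 \<le> r"
  shows "coregular r m G \<longleftrightarrow> simple_graph G \<and> card (sverts G) = m \<and> r \<le> m \<and>
    (\<forall>v\<in>sverts G. codegree G v = r - 1)"
proof -
  have "sdegree G v = m - r \<longleftrightarrow> codegree G v = r - 1"
    if "simple_graph G" "card (sverts G) = m" "r \<le> m" "v \<in> sverts G" for v
    using sdegree_add_codegree[OF that(1,4)] that(2,3) assms by linarith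
  then show ?thesis
    unfolding coregular_def sregular_def by blast
qed

definition induced :: "'a sgraph \<Rightarrow> 'a set \<Rightarrow> 'a sgraph" where
  "induced G W = \<lparr>sverts = W, sedges = {s \<in> sedges G. s \<subseteq> W}\<rparr>"

lemma induced_simps [simp]:
  "sverts (induced G W) = W" "sadj (induced G W) u v \<longleftrightarrow> sadj G u v \<and> u \<in> W \<and> v \<in> W"
  by (auto simp: induced_def sadj_def)

lemma simple_graph_induced:
  assumes "simple_graph G" "W \<subseteq> sverts G"
  shows "simple_graph (induced G W)"
  using assms by (auto simp: simple_graph_def induced_def intro: finite_subset)

text \<open>Every edge lies inside one side or crosses, and \<open>cross\<close> supplies all
  crossing pairs.\<close>

lemma sjoin_induced:
  assumes G: "simple_graph G" and part: "sverts G = A \<union> B" "A \<inter> B = {}"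
    and cross: "\<And>a b. a \<in> A \<Longrightarrow> b \<in> B \<Longrightarrow> sadj G a b"
  shows "sjoin (induced G A) (induced G B) = (G :: 'a sgraph)"
proof (rule sgraph.equality)
  show "sedges (sjoin (induced G A) (induced G B)) = sedges G"
  proof
    show "sedges (sjoin (induced G A) (induced G B)) \<subseteq> sedges G"
      using cross by (auto simp: sjoin_def induced_def sadj_def)
    show "sedges G \<subseteq> sedges (sjoin (induced G A) (induced G B))"
    proof
      fix s assume s: "s \<in> sedges G"
      then have "s \<subseteq> A \<union> B" "card s = 2"
        using G part by (auto simp: simple_graph_def)
      then obtain u v where uv: "s = {u, v}" by (auto simp: card_2_iff)
      then consider "s \<subseteq> A" | "s \<subseteq> B" | "u \<in> A" "v \<in> B" | "v \<in> A" "u \<in> B"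
        using \<open>s \<subseteq> A \<union> B\<close> by auto
      then show "s \<in> sedges (sjoin (induced G A) (induced G B))"
        by cases (use s uv in \<open>auto simp: sjoin_def induced_def\<close>)
    qed
  qed
qed (simp_all add: sjoin_def part)

text \<open>The setting in which \<open>sjoin\<close> is the genuine join.\<close>

locale disjoint_graphs =
  fixes H K :: "'a sgraph"
  assumes H: "simple_graph H" and K: "simple_graph K"
    and disj: "sverts H \<inter> sverts K = {}"
begin

lemma sverts_sjoin [simp]: "sverts (sjoin H K) = sverts H \<union> sverts K"
  by (simp add: sjoin_def)

lemma simple_graph_sjoin: "simple_graph (sjoin H K)"
proof -
  have "card {u, v} = 2" if "u \<in> sverts H" "v \<in> sverts K" for u v
    using that disj by (subst card_2_iff) blast
  then show ?thesis
    using H K by (auto simp: simple_graph_def sjoin_def)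
qed

lemma sadj_sjoin:
  "sadj (sjoin H K) u v \<longleftrightarrow> sadj H u v \<or> sadj K u v \<or>
    u \<in> sverts H \<and> v \<in> sverts K \<or> v \<in> sverts H \<and> u \<in> sverts K"
  unfolding sadj_def sjoin_def by (auto simp: doubleton_eq_iff)

text \<open>The complement of a join is the disjoint union of the complements, so complement degrees
  survive.\<close>

lemma codegree_sjoin_left:
  assumes "v \<in> sverts H"
  shows "codegree (sjoin H K) v = codegree H v"
proof -
  have "v \<notin> sverts K" using assms disj by auto
  then have "{u \<in> sverts (sjoin H K). u \<noteq> v \<and> \<not> sadj (sjoin H K) v u}
      = {u \<in> sverts H. u \<noteq> v \<and> \<not> sadj H v u}"
    using assms sadj_imp_verts(1)[OF K] disj by (auto simp: sadj_sjoin)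
  then show ?thesis by (simp add: codegree_def)
qed

lemma codegree_sjoin_right:
  assumes "v \<in> sverts K"
  shows "codegree (sjoin H K) v = codegree K v"
proof -
  have "v \<notin> sverts H" using assms disj by auto
  then have "{u \<in> sverts (sjoin H K). u \<noteq> v \<and> \<not> sadj (sjoin H K) v u}
      = {u \<in> sverts K. u \<noteq> v \<and> \<not> sadj K v u}"
    using assms sadj_imp_verts(1)[OF H] disj by (auto simp: sadj_sjoin)
  then show ?thesis by (simp add: codegree_def)
qed

lemma card_sverts_sjoin: "card (sverts (sjoin H K)) = card (sverts H) + card (sverts K)"
  using H K disj by (simp add: simple_graph_def card_Un_disjoint)

lemma sconnected_sjoin:
  assumes "sverts H \<noteq> {}" "sverts K \<noteq> {}"
  shows "sconnected (sjoin H K)"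
proof -
  obtain h k where hk: "h \<in> sverts H" "k \<in> sverts K" using assms by auto
  have "(sadj (sjoin H K))\<^sup>*\<^sup>* u v" if "u \<in> sverts H \<union> sverts K" "v \<in> sverts H \<union> sverts K" for u v
  proof -
    \<comment> \<open>The vertex \<open>h\<close> serves as a hub: vertices of \<open>K\<close> are
      adjacent to it, those of \<open>H\<close> reach it through \<open>k\<close>.\<close>
    have to_h: "(sadj (sjoin H K))\<^sup>*\<^sup>* u h \<and> (sadj (sjoin H K))\<^sup>*\<^sup>* h u"
      if "u \<in> sverts H \<union> sverts K" for u
    proof (cases "u \<in> sverts H")
      case True
      then have "sadj (sjoin H K) u k" "sadj (sjoin H K) k h" "sadj (sjoin H K) h k" "sadj (sjoin H K) k u"
        using hk by (auto simp: sadj_sjoin)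
      then show ?thesis by (meson converse_rtranclp_into_rtranclp r_into_rtranclp)
    next
      case False
      then have "sadj (sjoin H K) u h" "sadj (sjoin H K) h u"
        using hk that by (auto simp: sadj_sjoin)
      then show ?thesis by blast
    qed
    show ?thesis using to_h[OF that(1)] to_h[OF that(2)] by (meson rtranclp_trans)
  qed
  then show ?thesis using assms by (auto simp: sconnected_def)
qed

end

section \<open>Existence of the two factors\<close>

text \<open>One encoding for two complements: that of a perfect matching (\<open>\<sigma>\<close> a
  fixed-point-free involution) and that of a cycle (\<open>\<sigma>\<close> a cyclic shift).\<close>

definition co_permutation_graph :: "'a set \<Rightarrow> ('a \<Rightarrow> 'a) \<Rightarrow> 'a sgraph" where
  "co_permutation_graph V \<sigma> =
     \<lparr>sverts = V, sedges = {{u, v} | u v. u \<in> V \<and> v \<in> V \<and> u \<noteq> v \<and> \<sigma> u \<noteq> v \<and> \<sigma> v \<noteq> u}\<rparr>"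

lemma sadj_co_permutation_graph:
  "sadj (co_permutation_graph V \<sigma>) u v \<longleftrightarrow> u \<in> V \<and> v \<in> V \<and> u \<noteq> v \<and> \<sigma> u \<noteq> v \<and> \<sigma> v \<noteq> u"
  by (auto simp: co_permutation_graph_def sadj_def doubleton_eq_iff)

lemma simple_graph_co_permutation_graph:
  "finite V \<Longrightarrow> simple_graph (co_permutation_graph V \<sigma>)"
  by (auto simp: simple_graph_def co_permutation_graph_def card_2_iff)

text \<open>The non-neighbours of \<open>v\<close> are its image and its preimage,
  \<open>\<tau>\<close> being the inverse of \<open>\<sigma>\<close>; they coincide for an
  involution.\<close>

lemma codegree_co_permutation_graph:
  assumes "v \<in> V" and "\<And>u. u \<in> V \<Longrightarrow> \<sigma> u \<in> V \<and> \<tau> u \<in> V \<and> \<sigma> (\<tau> u) = u \<and> \<tau> (\<sigma> u) = u \<and> \<sigma> u \<noteq> u"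
  shows "codegree (co_permutation_graph V \<sigma>) v = card {\<sigma> v, \<tau> v}"
proof -
  have v: "\<sigma> v \<in> V" "\<tau> v \<in> V" "\<sigma> (\<tau> v) = v" "\<sigma> v \<noteq> v" "\<tau> v \<noteq> v"
    using assms(2)[OF assms(1)] by auto
  have inv: "\<sigma> u = v \<longleftrightarrow> u = \<tau> v" if "u \<in> V" for u
    using assms(2)[OF that] v(3) by auto
  have "{u \<in> V. u \<noteq> v \<and> \<not> sadj (co_permutation_graph V \<sigma>) v u} = {\<sigma> v, \<tau> v}"
    using v inv \<open>v \<in> V\<close> by (auto simp: sadj_co_permutation_graph)
  then show ?thesis by (simp add: codegree_def co_permutation_graph_def)
qed

lemma coregular_2_exists:
  fixes a k :: nat
  assumes "even a" "1 \<le> k"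
  shows "\<exists>H. coregular 2 (2 * k) H \<and> sverts H = {a..<a + 2 * k}"
proof -
  \<comment> \<open>Swaps each even number with its successor; an interval of even length with even
    start \<open>a\<close> is a union of such pairs.\<close>
  define \<sigma> :: "nat \<Rightarrow> nat" where "\<sigma> v = (if even v then v + 1 else v - 1)" for v
  let ?V = "{a..<a + 2 * k}"
  let ?H = "co_permutation_graph ?V \<sigma>"
  have "\<sigma> v \<in> ?V \<and> \<sigma> (\<sigma> v) = v \<and> \<sigma> v \<noteq> v" if "v \<in> ?V" for v
  proof (cases "even v")
    case True
    then have "v + 1 \<noteq> a + 2 * k" using \<open>even a\<close> by (metis even_add even_mult_iff even_numeral odd_one)
    then show ?thesis using True that by (auto simp: \<sigma>_def)
  next
    case False
    then have "v \<noteq> a" "v > 0" using \<open>even a\<close> by (auto simp: odd_pos)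
    then show ?thesis using False that by (auto simp: \<sigma>_def)
  qed
  then have "codegree ?H v = 1" if "v \<in> ?V" for v
    using codegree_co_permutation_graph[of v ?V \<sigma> \<sigma>] that by simp
  moreover have "sverts ?H = ?V" by (simp add: co_permutation_graph_def)
  ultimately show ?thesis
    using assms by (intro exI[of _ ?H])
      (simp add: coregular_iff_codegree simple_graph_co_permutation_graph)
qed

text \<open>The complement of a cycle; \<open>3 \<le> m\<close> makes the successor and predecessor
  of a vertex distinct.\<close>

lemma coregular_3_exists:
  fixes m :: nat
  assumes "3 \<le> m"
  shows "\<exists>K. coregular 3 m K \<and> sverts K = {..<m}"
proof -
  define \<sigma> :: "nat \<Rightarrow> nat" where "\<sigma> v = (if v + 1 = m then 0 else v + 1)" for v
  define \<tau> :: "nat \<Rightarrow> nat" where "\<tau> v = (if v = 0 then m - 1 else v - 1)" for v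
  let ?K = "co_permutation_graph {..<m} \<sigma>"
  have "codegree ?K v = 2" if "v \<in> {..<m}" for v
  proof -
    have "codegree ?K v = card {\<sigma> v, \<tau> v}"
      using that assms by (intro codegree_co_permutation_graph) (auto simp: \<sigma>_def \<tau>_def)
    moreover have "\<sigma> v \<noteq> \<tau> v" using that assms by (auto simp: \<sigma>_def \<tau>_def)
    ultimately show ?thesis by simp
  qed
  moreover have "sverts ?K = {..<m}" by (simp add: co_permutation_graph_def)
  ultimately show ?thesis
    using assms by (intro exI[of _ ?K])
      (simp add: coregular_iff_codegree simple_graph_co_permutation_graph)
qed

section \<open>Balanced graphs are exactly the claimed joins\<close>

lemma sjoin_coregular:
  assumes H: "coregular 2 a H" and K: "coregular 3 b K" and "sverts H \<inter> sverts K = {}"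
  shows "simple_graph (sjoin H K)" "sconnected (sjoin H K)"
    "card (sverts (sjoin H K)) = a + b"
    "(\<Sum>v\<in>sverts (sjoin H K). codegree (sjoin H K) v) = a + 2 * b"
    "codegree_balanced (sjoin H K)"
proof -
  have H': "simple_graph H" "card (sverts H) = a" "2 \<le> a" "\<And>v. v \<in> sverts H \<Longrightarrow> codegree H v = 1"
    and K': "simple_graph K" "card (sverts K) = b" "3 \<le> b" "\<And>v. v \<in> sverts K \<Longrightarrow> codegree K v = 2"
    using H K by (auto simp: coregular_iff_codegree)
  interpret disjoint_graphs H K
    using H' K' assms(3) by unfold_locales auto
  have fin: "finite (sverts H)" "finite (sverts K)"
    using H' K' by (auto simp: simple_graph_def)
  have cH: "codegree (sjoin H K) v = 1" if "v \<in> sverts H" for v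
    using that codegree_sjoin_left H'(4) by simp
  have cK: "codegree (sjoin H K) v = 2" if "v \<in> sverts K" for v
    using that codegree_sjoin_right K'(4) by simp
  show "simple_graph (sjoin H K)" by (rule simple_graph_sjoin)
  have "sverts H \<noteq> {}" "sverts K \<noteq> {}" using H' K' by auto
  then show "sconnected (sjoin H K)" by (rule sconnected_sjoin)
  show "card (sverts (sjoin H K)) = a + b"
    using card_sverts_sjoin H' K' by simp
  have "(\<Sum>v\<in>sverts (sjoin H K). codegree (sjoin H K) v)
      = (\<Sum>v\<in>sverts H. codegree (sjoin H K) v) + (\<Sum>v\<in>sverts K. codegree (sjoin H K) v)"
    using fin disj by (simp add: sum.union_disjoint)
  then show "(\<Sum>v\<in>sverts (sjoin H K). codegree (sjoin H K) v) = a + 2 * b"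
    using cH cK H' K' by simp
  show "codegree_balanced (sjoin H K)"
    unfolding codegree_balanced_def using cH cK by (auto simp: sadj_sjoin)
qed

text \<open>Split the vertices by codegree. No complement edge joins the two classes, so the graph
  is the join of the parts they induce; the vertex count and the codegree sum are two linear
  equations that fix the class sizes.\<close>

lemma codegree_balanced_imp_sjoin:
  assumes G: "simple_graph G" and bal: "codegree_balanced G"
    and card: "card (sverts G) = a + b" and sum: "(\<Sum>v\<in>sverts G. codegree G v) = a + 2 * b"
    and "2 \<le> a" "3 \<le> b"
  shows "\<exists>H K. coregular 2 a H \<and> coregular 3 b K \<and> sverts H \<inter> sverts K = {} \<and> G = sjoin H K"
proof -
  define A where "A = {v \<in> sverts G. codegree G v = 1}"
  define B where "B = {v \<in> sverts G. codegree G v = 2}"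
  let ?H = "induced G A" and ?K = "induced G B"
  have part: "sverts G = A \<union> B" "A \<inter> B = {}"
    using bal by (auto simp: A_def B_def codegree_balanced_def)
  have fin: "finite A" "finite B"
    using G by (auto simp: simple_graph_def A_def B_def)
  have "card A + card B = a + b"
    using card part fin by (simp add: card_Un_disjoint)
  moreover have "(\<Sum>v\<in>sverts G. codegree G v) = (\<Sum>v\<in>A. codegree G v) + (\<Sum>v\<in>B. codegree G v)"
    unfolding part(1) by (rule sum.union_disjoint[OF fin part(2)])
  then have "card A + 2 * card B = a + 2 * b"
    using sum by (simp add: A_def B_def)
  ultimately have cards: "card A = a" "card B = b" by auto
  have cross: "sadj G u v" if "u \<in> A" "v \<in> B" for u v
  proof (rule ccontr)
    assume "\<not> sadj G u v"
    moreover have "u \<in> sverts G" "v \<in> sverts G" "v \<noteq> u" using that part by auto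
    ultimately have "codegree G v = codegree G u"
      using bal by (simp add: codegree_balanced_def)
    then show False using that by (simp add: A_def B_def)
  qed
  have join: "sjoin ?H ?K = G"
    by (rule sjoin_induced[OF G part cross])
  interpret disjoint_graphs ?H ?K
    by unfold_locales (use G part in \<open>auto intro: simple_graph_induced\<close>)
  \<comment> \<open>Since \<open>G\<close> is the join of the two parts, codegrees within a part
    agree with those in \<open>G\<close>.\<close>
  have "codegree ?H v = 1" if "v \<in> A" for v
    using codegree_sjoin_left[of v] that unfolding join by (simp add: A_def)
  moreover have "codegree ?K v = 2" if "v \<in> B" for v
    using codegree_sjoin_right[of v] that unfolding join by (simp add: B_def)
  ultimately have "coregular 2 a ?H" "coregular 3 b ?K"
    using H K cards assms(5,6) by (auto simp: coregular_iff_codegree)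
  then show ?thesis using disj join by metis
qed

section \<open>The minimum and the minimizers\<close>

theorem theorem3p12:
  fixes n p e :: nat
  assumes "n \<ge> 5" and "odd n"
    and "1 \<le> p" and "p \<le> (n - 3) div 2"
    and "e = (n choose 2) - ((n + 1) div 2 + p)"
  shows "rho_min n e =
           (real n - 5 + sqrt (real n * (real n + 2) - 8 * real p - 3)) / 2
         \<and> minimizers n e =
           {G. \<exists>H K. coregular 2 (n - 2 * (p + 1) + 1) H \<and>
                     coregular 3 (2 * (p + 1) - 1) K \<and>
                     sverts H \<inter> sverts K = {} \<and>
                     G = sjoin H K}"
proof -
  define a b where "a = n - 2 * (p + 1) + 1" and "b = 2 * (p + 1) - 1"
  \<comment> \<open>The larger root of
    \<open>(\<mu> + 1) * (\<mu> + 2) = n * (\<mu> + 2) - (2 * p + 1)\<close>, where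
    \<open>2 * p + 1\<close> is the codegree sum minus \<open>n\<close>.\<close>
  define \<mu> where "\<mu> = (real n - 3 + sqrt (real n * (real n + 2) - 8 * real p - 3)) / 2"
  define joins where "joins = {G. \<exists>H K. coregular 2 a H \<and> coregular 3 b K \<and>
    sverts H \<inter> sverts K = {} \<and> G = (sjoin H K :: nat sgraph)}"
  obtain k where k: "n = 2 * k + 1" using \<open>odd n\<close> by (rule oddE)
  have kp: "2 \<le> k" "p + 1 \<le> k" using assms(1,4) k by auto
  have ab: "a = 2 * (k - p)" "b = 2 * p + 1" "a + b = n" "a + 2 * b = n + 2 * p + 1"
    using kp by (simp_all add: a_def b_def k)
  have ab_ge: "2 \<le> a" "3 \<le> b" using kp \<open>1 \<le> p\<close> ab by auto
  \<comment> \<open>Shows that the subtraction defining \<open>e\<close> is not truncated.\<close>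
  have "n choose 2 = k * n" by (simp add: choose_two k)
  moreover have "k + 1 + p \<le> k * n"
  proof -
    have "2 * k \<le> k * k" using kp by simp
    moreover have "k * n = k * k + k * k + k" by (simp add: k algebra_simps)
    ultimately show ?thesis using kp by linarith
  qed
  ultimately have "e + (k + 1 + p) = k * n" using assms(5) k by simp
  moreover have "n * n = 2 * (k * n) + n" by (simp add: k algebra_simps)
  \<comment> \<open>Against \<open>sum_codegree\<close>: with \<open>e\<close> edges the codegrees
    sum to \<open>a + 2 * b\<close>, as if \<open>a\<close> vertices had codegree 1 and
    \<open>b\<close> had codegree 2.\<close>
  ultimately have edges: "a + 2 * b + 2 * e + n = n * n"
    using ab(4) k by linarith

  have "real (2 * p + 3) \<le> real n" using kp k by simp
  then have p_le: "2 * real p + 3 \<le> real n" by simp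
  \<comment> \<open>By \<open>p_le\<close> the radicand is at least
    \<open>(n - 1)\<^sup>2 + 8\<close>.\<close>
  have "0 \<le> (real n - 1)\<^sup>2" by simp
  then have "0 \<le> real n * (real n + 2) - 8 * real p - 3"
    using p_le by (simp add: power2_eq_square algebra_simps)
  moreover have "2 * \<mu> - real n + 3 = sqrt (real n * (real n + 2) - 8 * real p - 3)"
    unfolding \<mu>_def by (simp add: field_simps)
  ultimately have sq: "(2 * \<mu> - real n + 3)\<^sup>2 = real n * (real n + 2) - 8 * real p - 3"
    and "2 * \<mu> - real n + 3 \<ge> 0"
    by simp_all
  have "\<mu> > 0"
    using \<open>2 * \<mu> - real n + 3 \<ge> 0\<close> assms(1) by linarith
  have root: "(\<mu> + 1) * (\<mu> + 2) = real n * (\<mu> + 2) - (real (a + 2 * b) - real n)"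
    using sq unfolding ab(4) by (simp add: power2_eq_square algebra_simps)

  have G: "simple_graph G" "sverts G \<noteq> {}" "card (sverts G) = a + b"
    "(\<Sum>v\<in>sverts G. codegree G v) = a + 2 * b" if "G \<in> conn_graphs n e" for G
  proof -
    show "simple_graph G" "sverts G \<noteq> {}" "card (sverts G) = a + b"
      using that ab(3) by (auto simp: conn_graphs_def sconnected_def)
    show "(\<Sum>v\<in>sverts G. codegree G v) = a + 2 * b"
      using sum_codegree[OF \<open>simple_graph G\<close>] that edges by (simp add: conn_graphs_def)
  qed
  have bound: "\<mu> - 1 \<le> spec_rad G" and eq: "spec_rad G = \<mu> - 1 \<longleftrightarrow> codegree_balanced G"
    if "G \<in> conn_graphs n e" for G
    using spec_rad_bound[of G \<mu>] G[OF that] \<open>\<mu> > 0\<close> root ab(3) by simp_all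
  have joins: "joins = {G \<in> conn_graphs n e. spec_rad G = \<mu> - 1}"
  proof (intro equalityI subsetI)
    fix J assume "J \<in> joins"
    then obtain H K where HK: "coregular 2 a H" "coregular 3 b K" "sverts H \<inter> sverts K = {}"
      and J: "J = sjoin H K" by (auto simp: joins_def)
    note J_props = sjoin_coregular[OF HK, folded J]
    have "card (sedges J) = e"
      using sum_codegree[OF J_props(1)] J_props(3,4) edges ab(3) by simp
    then have "J \<in> conn_graphs n e"
      using J_props ab(3) by (simp add: conn_graphs_def)
    then show "J \<in> {G \<in> conn_graphs n e. spec_rad G = \<mu> - 1}"
      using eq J_props(5) by simp
  next
    fix J assume "J \<in> {G \<in> conn_graphs n e. spec_rad G = \<mu> - 1}"
    then have "J \<in> conn_graphs n e" "codegree_balanced J" using eq by auto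
    then show "J \<in> joins"
      using codegree_balanced_imp_sjoin[of J a b] G[of J] ab_ge by (simp add: joins_def)
  qed
  have "joins \<noteq> {}"
  proof -
    obtain K :: "nat sgraph" where K: "coregular 3 b K" "sverts K = {..<b}"
      using coregular_3_exists ab_ge(2) by blast
    \<comment> \<open>As \<open>b\<close> is odd and the matching needs an even start, the vertices
      of \<open>H\<close> begin at \<open>b + 1\<close>, skipping the label
      \<open>b\<close>.\<close>
    have "even (b + 1)" by (simp add: ab)
    moreover have "1 \<le> k - p" using kp by simp
    ultimately obtain H :: "nat sgraph" where H: "coregular 2 a H" "sverts H = {b + 1..<b + 1 + a}"
      using coregular_2_exists[of "b + 1" "k - p"] unfolding ab(1) by blast
    have "sverts H \<inter> sverts K = {}" using H K by auto
    then show ?thesis using H K unfolding joins_def by blast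
  qed
  then have "\<mu> - 1 \<in> spec_rad ` conn_graphs n e"
    unfolding joins by force
  then have "rho_min n e = \<mu> - 1"
    unfolding rho_min_def using bound by (intro Least_equality) auto
  moreover have "\<mu> - 1 = (real n - 5 + sqrt (real n * (real n + 2) - 8 * real p - 3)) / 2"
    by (simp add: \<mu>_def field_simps)
  moreover have "minimizers n e = joins"
    unfolding minimizers_def joins \<open>rho_min n e = \<mu> - 1\<close> ..
  ultimately show ?thesis
    unfolding joins_def a_def b_def by simp
qed

end
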